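(* Let $X$ be a separable Banach space having a basis $\{e_k\}_{k=1}^\infty$ such that the left-shift $L$ and right-shift $R$ with respect to $\{e_k\}_{k=1}^\infty$ extend to bounded linear operators on $X$. Choose $\lambda>\|R\|$ and let $T:=\lambda L$ and $S:=\lambda^{-1}R$. Let $\{f_k\}_{k=1}^\infty\subset X$ and assume that for every $k\in\mathbb N$ there exists an integer $N(k)$ such that $f_k\in \mathrm{span}\{e_j\}_{j=1}^{N(k)}$. Fix any sequence $\{\epsilon_k\}_{k=1}^\infty\in\ell^1$ consisting of positive numbers, and choose a sequence $\{\alpha(k)\}_{k\in\mathbb N}$ of nonnegative integers such that $$\alpha(k)-\alpha(k-1)\ \ge\ \max\left\{\frac{\ln\epsilon_k-\ln\|f_k\|}{\ln\|S\|},\ N(k-1),\ N(k)\right\},\qquad k\ge 2.$$ Let $$\varphi:=\sum_{j=1}^\infty S^{\alpha(j)}f_j .$$ Then this series converges in $X$ (so $\varphi$ is well-defined), and for all $k\in\mathbb N$, $$\|f_k-T^{\alpha(k)}\varphi\|\ \le\ \sum_{j=k+1}^\infty\epsilon_j .$$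
   Context: A sequence $\{e_k\}_{k=1}^\infty$ in a Banach space $X$ is a (Schauder) basis if every $x\in X$ has a unique representation $x=\sum_{k=1}^\infty c_ke_k$ with scalars $c_k\in\mathbb C$. The left-shift and right-shift operators with respect to the basis are the linear maps $L,R:\mathrm{span}\{e_k\}_{k=1}^\infty\to X$ given by $Le_1=0$, $Le_k=e_{k-1}$ for $k\ge2$, and $Re_k=e_{k+1}$ for $k\in\mathbb N$; their bounded extensions to $X$ are denoted by the same letters. Note that $\lambda>\|R\|$ gives $\|S\|<1$. If $f_k=0$, then $\ln\|f_k\|=-\infty$ and the quotient $\frac{\ln\epsilon_k-\ln\|f_k\|}{\ln\|S\|}$ is read as $-\infty$ (i.e. it imposes no condition). The integers $N(k)$ are positive. *)

theory Defs
  imports "HOL-Analysis.Analysis"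
begin

text \<open>
  A complex normed space is a real normed space whose scalar multiplication extends to the
  complex numbers.  Topology, completeness and \<^const>\<open>onorm\<close> are those of the underlying
  real normed space.
\<close>

class complex_normed_vector = real_normed_vector +
  fixes scaleC :: "complex \<Rightarrow> 'a \<Rightarrow> 'a"  (infixr \<open>*\<^sub>C\<close> 75)
  assumes scaleC_add_right: "a *\<^sub>C (x + y) = a *\<^sub>C x + a *\<^sub>C y"
    and scaleC_add_left: "(a + b) *\<^sub>C x = a *\<^sub>C x + b *\<^sub>C x"
    and scaleC_scaleC: "a *\<^sub>C b *\<^sub>C x = (a * b) *\<^sub>C x"
    and scaleC_one: "1 *\<^sub>C x = x"
    and scaleR_scaleC: "r *\<^sub>R x = complex_of_real r *\<^sub>C x"
    and norm_scaleC: "norm (a *\<^sub>C x) = cmod a * norm x"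

class complex_banach = complex_normed_vector + banach

interpretation complex_vector: vector_space "scaleC :: complex \<Rightarrow> 'a \<Rightarrow> 'a::complex_normed_vector"
  by unfold_locales (simp_all add: scaleC_add_right scaleC_add_left scaleC_scaleC scaleC_one)

definition bounded_clinear ::
  "('a::complex_normed_vector \<Rightarrow> 'b::complex_normed_vector) \<Rightarrow> bool" where
  "bounded_clinear F \<longleftrightarrow> bounded_linear F \<and> Vector_Spaces.linear scaleC scaleC F"

text \<open>
  All sequences are indexed by \<open>1, 2, 3, \<dots>\<close>; the value at index \<open>0\<close> is never used.  In
  particular \<open>c k\<close> below is the coefficient of \<open>e (Suc k)\<close>.
\<close>

definition schauder_basis :: "(nat \<Rightarrow> 'a::complex_normed_vector) \<Rightarrow> bool" where
  "schauder_basis e \<longleftrightarrow> (\<forall>x. \<exists>!c. (\<lambda>k. c k *\<^sub>C e (Suc k)) sums x)"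

text \<open>
  The shifts are linear on the span of the basis, so a linear operator on the whole space
  extends a shift as soon as it has the prescribed values on the basis vectors.
\<close>

definition bounded_left_shift ::
  "(nat \<Rightarrow> 'a::complex_normed_vector) \<Rightarrow> ('a \<Rightarrow> 'a) \<Rightarrow> bool" where
  "bounded_left_shift e L \<longleftrightarrow>
     bounded_clinear L \<and> L (e 1) = 0 \<and> (\<forall>k\<ge>2. L (e k) = e (k - 1))"

definition bounded_right_shift ::
  "(nat \<Rightarrow> 'a::complex_normed_vector) \<Rightarrow> ('a \<Rightarrow> 'a) \<Rightarrow> bool" where
  "bounded_right_shift e R \<longleftrightarrow> bounded_clinear R \<and> (\<forall>k\<ge>1. R (e k) = e (k + 1))"

text \<open>
  The logarithm on the nonnegative reals with \<open>ln 0 = -\<infinity>\<close>, unlike \<^term>\<open>ln (0::real)\<close>,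
  which is \<open>0\<close>.
\<close>

definition extended_ln :: "real \<Rightarrow> ereal" where
  "extended_ln t = (if t = 0 then - \<infinity> else ereal (ln t))"

end

theory Submission
  imports Defs
begin

text \<open>
  Since \<open>T \<circ> S = id\<close>, applying \<open>T ^^ \<alpha> k\<close> to the series for \<open>\<phi>\<close> turns the \<open>j\<close>-th term into
  \<open>(T ^^ (\<alpha> k - \<alpha> j)) (f j)\<close> for \<open>j \<le> k\<close> and into \<open>(S ^^ (\<alpha> j - \<alpha> k)) (f j)\<close> for \<open>j > k\<close>.
  The terms with \<open>j < k\<close> vanish because \<open>L\<close> is nilpotent on the span of the first \<open>N j\<close> basis
  vectors and \<open>\<alpha> k - \<alpha> j \<ge> N j\<close>; the term with \<open>j = k\<close> is \<open>f k\<close>; and since \<open>S\<close> is a strict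
  contraction, the gap condition bounds the term with \<open>j > k\<close> by \<open>\<epsilon> j\<close>.
\<close>

section \<open>Iterates of linear maps and of one-sided inverses\<close>

lemma bounded_linear_funpow:
  fixes F :: "'a::real_normed_vector \<Rightarrow> 'a"
  assumes "bounded_linear F"
  shows "bounded_linear (F ^^ n)"
proof (induction n)
  case 0
  show ?case by (simp add: id_def)
next
  case (Suc n)
  then show ?case
    using bounded_linear_compose[OF assms Suc.IH] by (simp add: o_def)
qed

lemma norm_funpow_le:
  fixes F :: "'a::real_normed_vector \<Rightarrow> 'a"
  assumes "bounded_linear F"
  shows "norm ((F ^^ n) x) \<le> onorm F ^ n * norm x"
proof (induction n)
  case (Suc n)
  have "norm ((F ^^ Suc n) x) \<le> onorm F * norm ((F ^^ n) x)"
    using onorm[OF assms] by simp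
  also have "\<dots> \<le> onorm F * (onorm F ^ n * norm x)"
    using Suc.IH onorm_pos_le[OF assms] by (rule mult_left_mono)
  finally show ?case by (simp add: mult.assoc)
qed simp

lemma funpow_left_inverse:
  fixes T S :: "'a \<Rightarrow> 'a"
  assumes "\<And>x. T (S x) = x"
  shows "(T ^^ n) ((S ^^ n) x) = x"
proof (induction n arbitrary: x)
  case (Suc n)
  have "(T ^^ Suc n) ((S ^^ Suc n) x) = (T ^^ n) (T (S ((S ^^ n) x)))"
    by (simp add: funpow_swap1)
  then show ?case using Suc.IH assms by simp
qed simp

text \<open>Serves the terms of the series after the \<open>k\<close>-th, where some powers of
  \<open>S\<close> survive.\<close>

lemma funpow_left_inverse_le:
  fixes T S :: "'a \<Rightarrow> 'a"
  assumes "\<And>x. T (S x) = x" and "n \<le> m"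
  shows "(T ^^ n) ((S ^^ m) x) = (S ^^ (m - n)) x"
proof -
  have "(S ^^ m) x = (S ^^ n) ((S ^^ (m - n)) x)"
    using \<open>n \<le> m\<close> by (metis comp_apply funpow_add le_add_diff_inverse)
  then show ?thesis using funpow_left_inverse[of T S, OF assms(1)] by simp
qed

text \<open>Serves the terms before the \<open>k\<close>-th, where surplus powers of
  \<open>T\<close> remain to annihilate them.\<close>

lemma funpow_left_inverse_ge:
  fixes T S :: "'a \<Rightarrow> 'a"
  assumes "\<And>x. T (S x) = x" and "m \<le> n"
  shows "(T ^^ n) ((S ^^ m) x) = (T ^^ (n - m)) x"
proof -
  have "(T ^^ n) ((S ^^ m) x) = (T ^^ (n - m)) ((T ^^ m) ((S ^^ m) x))"
    using \<open>m \<le> n\<close> by (metis comp_apply funpow_add le_add_diff_inverse2)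
  then show ?thesis using funpow_left_inverse[of T S, OF assms(1)] by simp
qed

lemma funpow_scaleR:
  fixes F :: "'a::real_vector \<Rightarrow> 'a"
  assumes "linear F"
  shows "((\<lambda>x. c *\<^sub>R F x) ^^ n) x = c ^ n *\<^sub>R (F ^^ n) x"
  by (induction n) (simp_all add: linear_cmul[OF assms])

section \<open>Bounded complex-linear operators and Schauder bases\<close>

lemma bounded_clinear_scaleC:
  assumes "bounded_clinear F"
  shows "F (c *\<^sub>C x) = c *\<^sub>C F x"
proof -
  have "Vector_Spaces.linear scaleC scaleC F"
    using assms by (simp add: bounded_clinear_def)
  then have "module_hom scaleC scaleC F"
    by (simp only: module_hom_iff_linear)
  then show ?thesis by (rule module_hom.scale)
qed

lemma bounded_clinear_bounded_linear:
  "bounded_clinear F \<Longrightarrow> bounded_linear F"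
  by (simp add: bounded_clinear_def)

text \<open>By continuity both operators may be applied termwise to the basis expansion of
  \<open>x\<close>.\<close>

lemma schauder_basis_clinear_eqI:
  assumes e: "schauder_basis e"
    and F: "bounded_clinear F" and G: "bounded_clinear G"
    and eq: "\<And>k. k \<ge> 1 \<Longrightarrow> F (e k) = G (e k)"
  shows "F x = G x"
proof -
  obtain c where c: "(\<lambda>k. c k *\<^sub>C e (Suc k)) sums x"
    using e unfolding schauder_basis_def by metis
  have "(\<lambda>k. c k *\<^sub>C F (e (Suc k))) sums F x"
    using bounded_linear.sums[OF bounded_clinear_bounded_linear[OF F] c]
    by (simp add: bounded_clinear_scaleC[OF F])
  moreover have "(\<lambda>k. c k *\<^sub>C G (e (Suc k))) sums G x"
    using bounded_linear.sums[OF bounded_clinear_bounded_linear[OF G] c]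
    by (simp add: bounded_clinear_scaleC[OF G])
  ultimately show ?thesis
    using eq sums_unique2 by fastforce
qed

text \<open>If \<open>e k\<close> were zero, its coefficient could be chosen freely, so the
  expansion of 0 would not be unique.\<close>

lemma schauder_basis_nonzero:
  assumes e: "schauder_basis e" and "k \<ge> 1"
  shows "e k \<noteq> 0"
proof
  assume "e k = 0"
  define c :: "nat \<Rightarrow> complex" where "c i = (if Suc i = k then 1 else 0)" for i
  have "c i *\<^sub>C e (Suc i) = 0" for i
    using \<open>e k = 0\<close> by (simp add: c_def)
  then have c: "(\<lambda>i. c i *\<^sub>C e (Suc i)) sums 0" by (simp only: sums_zero)
  define P where "P d \<longleftrightarrow> (\<lambda>i. d i *\<^sub>C e (Suc i)) sums 0" for d
  have "\<exists>!d. P d"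
    using e by (simp add: schauder_basis_def P_def)
  moreover have "P c" using c by (simp only: P_def)
  moreover have "P (\<lambda>i. 0)" by (simp add: P_def)
  ultimately have "c = (\<lambda>i. 0)" by blast
  then have "c (k - 1) = 0" by simp
  then show False using \<open>k \<ge> 1\<close> by (simp add: c_def)
qed

section \<open>The two shift operators\<close>

lemma left_shift_right_shift:
  assumes e: "schauder_basis e" and L: "bounded_left_shift e L" and R: "bounded_right_shift e R"
  shows "L (R x) = x"
proof -
  have cL: "bounded_clinear L" and cR: "bounded_clinear R"
    using L R by (simp_all add: bounded_left_shift_def bounded_right_shift_def)
  have "bounded_clinear (\<lambda>x. L (R x))"
    using cL cR bounded_linear_compose Vector_Spaces.linear_compose
    unfolding bounded_clinear_def o_def by blast
  moreover have "bounded_clinear (\<lambda>x::'a. x)"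
    unfolding bounded_clinear_def
    using bounded_linear_ident complex_vector.linear_ident by blast
  \<comment> \<open>The index reached by \<open>R\<close> is at least 2, so the exceptional value of
    \<open>L\<close> at \<open>e 1\<close> never enters.\<close>
  moreover have "L (R (e k)) = e k" if "k \<ge> 1" for k
    using that L R by (simp add: bounded_left_shift_def bounded_right_shift_def)
  ultimately show ?thesis
    by (rule schauder_basis_clinear_eqI[OF e])
qed

text \<open>Each application of \<open>L\<close> lowers the index by one, until \<open>e 1\<close>
  is sent to zero. The index \<open>j\<close> varies in the induction because \<open>L\<close> is
  applied to \<open>e j\<close> first.\<close>

lemma left_shift_funpow_basis:
  assumes L: "bounded_left_shift e L" and "1 \<le> j" "j \<le> n"
  shows "(L ^^ n) (e j) = 0"
  using \<open>1 \<le> j\<close> \<open>j \<le> n\<close>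
proof (induction n arbitrary: j)
  case (Suc n)
  have bl: "bounded_linear L"
    using L by (simp add: bounded_left_shift_def bounded_clinear_def)
  show ?case
  proof (cases "j = 1")
    case True
    then have "L (e j) = 0" using L by (simp add: bounded_left_shift_def)
    then show ?thesis
      using linear_0[OF bounded_linear.linear[OF bounded_linear_funpow[OF bl]]]
      by (simp add: funpow_Suc_right del: funpow.simps)
  next
    case False
    then have "L (e j) = e (j - 1)"
      using L Suc.prems by (simp add: bounded_left_shift_def)
    then show ?thesis
      using Suc.IH[of "j - 1"] Suc.prems False
      by (simp add: funpow_Suc_right del: funpow.simps)
  qed
qed simp

text \<open>The kernel of \<open>L ^^ n\<close> is a complex subspace containing the spanning
  vectors.\<close>

lemma left_shift_funpow_span:
  assumes L: "bounded_left_shift e L" and x: "x \<in> complex_vector.span (e ` {1..N})" and "N \<le> n"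
  shows "(L ^^ n) x = 0"
proof -
  have cL: "bounded_clinear L" using L by (simp add: bounded_left_shift_def)
  \<comment> \<open>The span is complex, whereas \<open>bounded_linear_funpow\<close> yields only
    real linearity of the iterate.\<close>
  have scale: "(L ^^ n) (c *\<^sub>C y) = c *\<^sub>C (L ^^ n) y" for c y
    by (induction n) (simp_all add: bounded_clinear_scaleC[OF cL])
  have lin: "linear (L ^^ n)"
    using bounded_linear_funpow[OF bounded_clinear_bounded_linear[OF cL]]
    by (rule bounded_linear.linear)
  have sub: "complex_vector.subspace {y. (L ^^ n) y = 0}"
    by (simp add: complex_vector.subspace_def linear_0[OF lin] linear_add[OF lin] scale)
  show ?thesis
    using x
  proof (induction rule: complex_vector.span_induct)
    case base
    show ?case by (rule sub)
  next
    case (step y)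
    then show ?case
      using left_shift_funpow_basis[OF L] \<open>N \<le> n\<close> by auto
  qed
qed

text \<open>\<open>R\<close> maps \<open>e 1\<close> to the nonzero vector \<open>e 2\<close>. This
  makes \<open>lam\<close> positive and keeps the logarithm of \<open>onorm S\<close>
  finite.\<close>

lemma right_shift_onorm_pos:
  assumes e: "schauder_basis e" and R: "bounded_right_shift e R"
  shows "onorm R > 0"
proof -
  have "bounded_linear R"
    using R by (simp add: bounded_right_shift_def bounded_clinear_def)
  moreover have "R (e 1) = e 2"
    using R by (simp add: bounded_right_shift_def eval_nat_numeral)
  then have "R (e 1) \<noteq> 0"
    using schauder_basis_nonzero[OF e, of 2] by simp
  ultimately show ?thesis
    using onorm_pos_lt by blast
qed

section \<open>From logarithmic gaps to geometric decay\<close>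

lemma power_mult_le_of_extended_ln:
  assumes q: "0 < q" "q < 1" and "0 < \<epsilon>" "0 \<le> t"
    and gap: "(extended_ln \<epsilon> - extended_ln t) / extended_ln q \<le> ereal (real d)"
  shows "q ^ d * t \<le> \<epsilon>"
\<comment> \<open>For \<open>t = 0\<close> the quotient is minus infinity and \<open>gap\<close>
  says nothing, but then the left side of the claim is 0.\<close>
proof (cases "t = 0")
  case False
  then have t: "t > 0" using \<open>0 \<le> t\<close> by simp
  have lnq: "ln q < 0" using q by simp
  have "(ln \<epsilon> - ln t) / ln q \<le> real d"
    using gap t q \<open>0 < \<epsilon>\<close> lnq by (simp add: extended_ln_def)
  \<comment> \<open>Multiplying by the negative number \<open>ln q\<close> turns the lower bound on
    the exponent into an upper bound.\<close>
  then have "real d * ln q \<le> ln \<epsilon> - ln t"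
    using lnq by (simp add: neg_divide_le_eq)
  then have "ln (q ^ d * t) \<le> ln \<epsilon>"
    using t q by (simp add: ln_mult ln_realpow)
  then show ?thesis
    using t q \<open>0 < \<epsilon>\<close> by simp
qed (use \<open>0 < \<epsilon>\<close> in simp)

section \<open>Convergence of the series and approximation along the orbit\<close>

theorem theorem2p1:
  fixes e f :: "nat \<Rightarrow> 'a::complex_banach"
    and L R T S :: "'a \<Rightarrow> 'a"
    and lam :: real
    and N \<alpha> :: "nat \<Rightarrow> nat"
    and \<epsilon> :: "nat \<Rightarrow> real"
    and \<phi> :: 'a
  assumes separable: "separable_space (euclidean :: 'a topology)"
    and basis: "schauder_basis e"
    and left_shift: "bounded_left_shift e L"
    and right_shift: "bounded_right_shift e R"
    and lam: "lam > onorm R"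
    and T: "T = (\<lambda>x. lam *\<^sub>R L x)"
    and S: "S = (\<lambda>x. inverse lam *\<^sub>R R x)"
    and N_pos: "\<forall>k\<ge>1. N k \<ge> 1"
    and f_span: "\<forall>k\<ge>1. f k \<in> complex_vector.span (e ` {1..N k})"
    and eps_pos: "\<forall>k\<ge>1. \<epsilon> k > 0"
    and eps_l1: "summable (\<lambda>k. \<bar>\<epsilon> (Suc k)\<bar>)"
    and gaps: "\<forall>k\<ge>2. ereal (real (\<alpha> k) - real (\<alpha> (k - 1))) \<ge>
        Max {(extended_ln (\<epsilon> k) - extended_ln (norm (f k))) / extended_ln (onorm S),
             ereal (real (N (k - 1))), ereal (real (N k))}"
    and phi: "\<phi> = (\<Sum>j. (S ^^ \<alpha> (Suc j)) (f (Suc j)))"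
  shows "summable (\<lambda>j. (S ^^ \<alpha> (Suc j)) (f (Suc j))) \<and>
    (\<forall>k\<ge>1. norm (f k - (T ^^ \<alpha> k) \<phi>) \<le> (\<Sum>j. \<epsilon> (j + (k + 1))))"
proof -
  have blL: "bounded_linear L" and blR: "bounded_linear R"
    using left_shift right_shift
    by (simp_all add: bounded_left_shift_def bounded_right_shift_def bounded_clinear_def)
  have R_pos: "onorm R > 0" using right_shift_onorm_pos[OF basis right_shift] .
  then have lam_pos: "lam > 0" using lam by linarith
  have blT: "bounded_linear T" and blS: "bounded_linear S"
    unfolding T S by (rule bounded_linear_const_scaleR[OF blL], rule bounded_linear_const_scaleR[OF blR])
  have onorm_S: "onorm S = onorm R / lam"
    unfolding S onorm_scaleR[OF blR] using lam_pos by (simp add: field_simps)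
  have q: "0 < onorm S" "onorm S < 1"
    using R_pos lam lam_pos by (simp_all add: onorm_S)
  have TS: "T (S x) = x" for x
    using lam_pos left_shift_right_shift[OF basis left_shift right_shift]
    by (simp add: T S linear_cmul[OF bounded_linear.linear[OF blL]])
  have T_zero: "(T ^^ n) (f k) = 0" if "k \<ge> 1" "N k \<le> n" for n k
    unfolding T funpow_scaleR[OF bounded_linear.linear[OF blL]]
    using left_shift_funpow_span[OF left_shift _ that(2)] f_span that(1) by simp

  have gap_N: "\<alpha> k + N k \<le> \<alpha> (Suc k)" and gap_mono: "\<alpha> k \<le> \<alpha> (Suc k)"
    and gap_ln: "(extended_ln (\<epsilon> (Suc k)) - extended_ln (norm (f (Suc k)))) / extended_ln (onorm S)
      \<le> ereal (real (\<alpha> (Suc k) - \<alpha> k))" if "k \<ge> 1" for k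
  proof -
    have g: "(extended_ln (\<epsilon> (Suc k)) - extended_ln (norm (f (Suc k)))) / extended_ln (onorm S)
        \<le> ereal (real (\<alpha> (Suc k)) - real (\<alpha> k))"
      "ereal (real (N k)) \<le> ereal (real (\<alpha> (Suc k)) - real (\<alpha> k))"
      using gaps[rule_format, of "Suc k"] that by simp_all
    then show N: "\<alpha> k + N k \<le> \<alpha> (Suc k)" by simp
    then show "\<alpha> k \<le> \<alpha> (Suc k)" by simp
    \<comment> \<open>Subtraction of naturals truncates; monotonicity makes it agree with the real
      difference.\<close>
    then show "(extended_ln (\<epsilon> (Suc k)) - extended_ln (norm (f (Suc k)))) / extended_ln (onorm S)
      \<le> ereal (real (\<alpha> (Suc k) - \<alpha> k))"
      using g(1) by (simp add: of_nat_diff)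
  qed
  have mono: "\<alpha> i \<le> \<alpha> j" if "1 \<le> i" "i \<le> j" for i j
    using \<open>i \<le> j\<close>
  proof (induction j rule: dec_induct)
    case (step n)
    then show ?case using gap_mono[of n] that(1) by linarith
  qed simp

  \<comment> \<open>The exponent is left free above the last gap:
    \<open>m = \<alpha> (Suc j)\<close> gives convergence, and
    \<open>m = \<alpha> (Suc j) - \<alpha> k\<close> gives the tail estimate.\<close>
  have S_le: "norm ((S ^^ m) (f (Suc j))) \<le> \<epsilon> (Suc j)"
    if "j \<ge> 1" "\<alpha> (Suc j) - \<alpha> j \<le> m" for m j
  proof -
    have "norm ((S ^^ m) (f (Suc j))) \<le> onorm S ^ m * norm (f (Suc j))"
      by (rule norm_funpow_le[OF blS])
    also have "\<dots> \<le> onorm S ^ (\<alpha> (Suc j) - \<alpha> j) * norm (f (Suc j))"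
      using q that(2) by (intro mult_right_mono power_decreasing) auto
    also have "\<dots> \<le> \<epsilon> (Suc j)"
      using power_mult_le_of_extended_ln[OF q _ _ gap_ln[OF that(1)]] eps_pos by simp
    finally show ?thesis .
  qed

  let ?a = "\<lambda>j. (S ^^ \<alpha> (Suc j)) (f (Suc j))"
  have eps: "summable (\<lambda>k. \<epsilon> (Suc k))"
    using eps_l1 by (rule summable_rabs_cancel)
  have sum_a: "summable ?a"
  \<comment> \<open>The comparison starts at 1, since no gap condition controls the term of
    \<open>f 1\<close>.\<close>
  proof (rule summable_comparison_test'[OF eps, of 1])
    fix j :: nat assume "1 \<le> j"
    then show "norm (?a j) \<le> \<epsilon> (Suc j)" by (intro S_le) auto
  qed

  have "norm (f k - (T ^^ \<alpha> k) \<phi>) \<le> (\<Sum>j. \<epsilon> (j + (k + 1)))" if k: "k \<ge> 1" for k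
  proof -
    let ?b = "\<lambda>j. (T ^^ \<alpha> k) (?a j)"
    have blTk: "bounded_linear (T ^^ \<alpha> k)" by (rule bounded_linear_funpow[OF blT])
    have sum_b: "summable ?b"
      using bounded_linear.summable[OF blTk sum_a] .
    \<comment> \<open>\<open>?b j\<close> involves \<open>f (Suc j)\<close>, so the term of
      \<open>f k\<close> sits at \<open>j = k - 1\<close>.\<close>
    have head: "?b j = (if j = k - 1 then f k else 0)" if "j < k" for j
    proof (cases "j = k - 1")
      case True
      then show ?thesis using k funpow_left_inverse[of T S, OF TS] by simp
    next
      case False
      \<comment> \<open>Here \<open>Suc (Suc j) \<le> k\<close>, so the gap just after
        \<open>Suc j\<close> already leaves room for \<open>N (Suc j)\<close> powers of
        \<open>T\<close>.\<close>
      then have "\<alpha> (Suc j) + N (Suc j) \<le> \<alpha> k"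
        using gap_N[of "Suc j"] mono[of "Suc (Suc j)" k] that by linarith
      then show ?thesis
        using False T_zero[of "Suc j"] by (simp add: funpow_left_inverse_ge[of T S, OF TS])
    qed
    have tail: "norm (?b (j + k)) \<le> \<epsilon> (j + (k + 1))" for j
    proof -
      \<comment> \<open>Hence the exponent remaining on \<open>S\<close> is at least the single gap
        from \<open>j + k\<close> to \<open>Suc (j + k)\<close>, as \<open>S_le\<close>
        requires.\<close>
      have "\<alpha> k \<le> \<alpha> (j + k)" using mono k by simp
      moreover have "\<alpha> (j + k) \<le> \<alpha> (Suc (j + k))" using gap_mono[of "j + k"] k by simp
      ultimately show ?thesis
        using S_le[of "j + k" "\<alpha> (Suc (j + k)) - \<alpha> k"] k
        by (simp add: funpow_left_inverse_le[of T S, OF TS])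
    qed
    have eps_k: "summable (\<lambda>j. \<epsilon> (j + (k + 1)))"
      using summable_ignore_initial_segment[OF eps, of k] by simp
    \<comment> \<open>Continuity moves the iterate inside the series; the first \<open>k\<close>
      terms then sum to \<open>f k\<close>, and the error is the tail.\<close>
    have "(T ^^ \<alpha> k) \<phi> = (\<Sum>j. ?b j)"
      unfolding phi by (rule bounded_linear.suminf[OF blTk sum_a])
    also have "\<dots> = (\<Sum>j. ?b (j + k)) + (\<Sum>j<k. ?b j)"
      by (rule suminf_split_initial_segment[OF sum_b])
    also have "(\<Sum>j<k. ?b j) = (\<Sum>j<k. if j = k - 1 then f k else 0)"
      using head by (intro sum.cong) auto
    also have "\<dots> = f k" using k by simp
    finally have "norm (f k - (T ^^ \<alpha> k) \<phi>) = norm (\<Sum>j. ?b (j + k))"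
      by (simp add: norm_minus_commute)
    also have "\<dots> \<le> (\<Sum>j. \<epsilon> (j + (k + 1)))"
      using tail eps_k by (rule norm_suminf_le)
    finally show ?thesis .
  qed
  with sum_a show ?thesis by blast
qed

end
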